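(* Let $A$ be a commutative (not necessarily associative) algebra over $\mathbb{R}$, equipped with a Frobenius form $(\cdot,\cdot)$ that satisfies the Norton inequality $(x^2,y^2)\geq (xy,xy)$ for all $x,y\in A$. Then for every idempotent $e\in A$ and every $\lambda\in\{0,1\}$, $$(L_e-\lambda\,\mathrm{id}_A)\bigl(A_\lambda(e)A_\lambda(e)\bigr)\subseteq A^\perp,$$ and the mixed product satisfies the stronger inclusion $$A_0(e)A_1(e)\subseteq A^\perp.$$
   Context: An algebra here means a real vector space $A$ (of arbitrary dimension) with a bilinear commutative product, not necessarily associative and not necessarily unital. A Frobenius form on $A$ is a symmetric bilinear form $(\cdot,\cdot):A\times A\to\mathbb{R}$ with $(xy,z)=(x,yz)$ for all $x,y,z\in A$ (it is not assumed nondegenerate or positive). For $x\in A$, the adjoint operator $L_x:A\to A$ is $L_x(y)=xy$, and for $\lambda\in\mathbb{R}$, $A_\lambda(x)=\{v\in A: xv=\lambda v\}$. An idempotent is an element $e\in A$ with $e^2=e$. The radical of the form is $A^\perp=\{u\in A:(u,x)=0\ \text{for all } x\in A\}$. For subspaces $U,W\subseteq A$, $UW$ denotes the linear span of the products $uw$ with $u\in U$, $w\in W$. *)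

theory Defs
  imports "HOL-Analysis.Linear_Algebra"
begin

text \<open>
  The algebra is the whole type \<open>'a\<close> with its real vector space structure; the product is
  an explicit bilinear map rather than the multiplication of a type class, since no class
  for nonassociative algebras is available.
\<close>

definition commutative_algebra :: "('a::real_vector \<Rightarrow> 'a \<Rightarrow> 'a) \<Rightarrow> bool" where
  "commutative_algebra m \<longleftrightarrow> bilinear m \<and> (\<forall>x y. m x y = m y x)"

definition frobenius_form ::
  "('a::real_vector \<Rightarrow> 'a \<Rightarrow> 'a) \<Rightarrow> ('a \<Rightarrow> 'a \<Rightarrow> real) \<Rightarrow> bool" where
  "frobenius_form m B \<longleftrightarrow>
     bilinear B \<and> (\<forall>x y. B x y = B y x) \<and> (\<forall>x y z. B (m x y) z = B x (m y z))"

definition norton_inequality ::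
  "('a::real_vector \<Rightarrow> 'a \<Rightarrow> 'a) \<Rightarrow> ('a \<Rightarrow> 'a \<Rightarrow> real) \<Rightarrow> bool" where
  "norton_inequality m B \<longleftrightarrow> (\<forall>x y. B (m x x) (m y y) \<ge> B (m x y) (m x y))"

definition alg_idempotent :: "('a::real_vector \<Rightarrow> 'a \<Rightarrow> 'a) \<Rightarrow> 'a \<Rightarrow> bool" where
  "alg_idempotent m e \<longleftrightarrow> m e e = e"

definition adjoint_op :: "('a::real_vector \<Rightarrow> 'a \<Rightarrow> 'a) \<Rightarrow> 'a \<Rightarrow> 'a \<Rightarrow> 'a" where
  "adjoint_op m x = (\<lambda>y. m x y)"

definition alg_eigenspace :: "('a::real_vector \<Rightarrow> 'a \<Rightarrow> 'a) \<Rightarrow> real \<Rightarrow> 'a \<Rightarrow> 'a set" where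
  "alg_eigenspace m c x = {v. m x v = c *\<^sub>R v}"

definition subspace_product ::
  "('a::real_vector \<Rightarrow> 'a \<Rightarrow> 'a) \<Rightarrow> 'a set \<Rightarrow> 'a set \<Rightarrow> 'a set" where
  "subspace_product m U W = span {m u w | u w. u \<in> U \<and> w \<in> W}"

definition form_radical :: "('a::real_vector \<Rightarrow> 'a \<Rightarrow> real) \<Rightarrow> 'a set" where
  "form_radical B = {u. \<forall>x. B u x = 0}"

end

theory Submission
  imports Defs
begin

text \<open>
  For fixed \<open>x\<close> the Norton inequality says that the symmetric bilinear form
  \<open>N\<^sub>x(u, v) = (x\<^sup>2, uv) - (xu, xv)\<close> is positive semidefinite, so a vector with
  \<open>N\<^sub>x(u, u) = 0\<close> is in the kernel of \<open>N\<^sub>x\<close>. The proof exploits this together with the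
  symmetry \<open>N\<^sub>x(u, u) = N\<^sub>u(x, x)\<close>, which transfers isotropy between the two arguments.

  Let \<open>e\<close> be an idempotent. Vectors of \<open>A\<^sub>0(e)\<close> and \<open>A\<^sub>1(e)\<close> are isotropic for \<open>N\<^sub>e\<close>, hence so are
  their sums, because they lie in its kernel. If \<open>y\<close> is isotropic for \<open>N\<^sub>e\<close>, then \<open>e\<close> is
  isotropic for \<open>N\<^sub>y\<close>, and \<open>N\<^sub>y(e, \<cdot>) = 0\<close> reads \<open>e(yy) = (ey)y\<close> modulo the radical.
  Polarizing in \<open>y\<close> yields \<open>e(uv) = (a + b)/2 uv\<close> modulo the radical for \<open>u \<in> A\<^sub>a(e)\<close>,
  \<open>v \<in> A\<^sub>b(e)\<close> and \<open>a, b \<in> {0, 1}\<close> (lemma \<open>eigenvector_product\<close>). The case \<open>a = b\<close> is the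
  first inclusion.

  For \<open>u \<in> A\<^sub>0(e)\<close> and \<open>v \<in> A\<^sub>1(e)\<close> the product \<open>w = uv\<close> is thus a \<open>1/2\<close>-eigenvector modulo
  the radical, and \<open>N\<^sub>e(w, z) = (w, z)/4\<close> for all \<open>z\<close>; in particular \<open>(w, w) \<ge> 0\<close>.
  On the other hand \<open>uu\<close> and \<open>vv\<close> are orthogonal, being eigenvectors modulo the radical for \<open>0\<close>
  and \<open>1\<close>, so the Norton inequality for \<open>u\<close> and \<open>v\<close> gives \<open>(w, w) \<le> 0\<close>. Hence \<open>w\<close> is isotropic
  for \<open>N\<^sub>e\<close>, and \<open>(w, z) = 4 N\<^sub>e(w, z) = 0\<close> for all \<open>z\<close>.
\<close>

text \<open>
  Otherwise the affine function \<open>t \<mapsto> P (v + t u) (v + t u)\<close> would have nonzero slope and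
  take negative values.
\<close>

lemma isotropic_semidefinite:
  fixes P :: "'a::real_vector \<Rightarrow> 'a \<Rightarrow> real"
  assumes bil: "bilinear P" and sym: "\<And>x y. P x y = P y x"
    and pos: "\<And>x. P x x \<ge> 0" and iso: "P u u = 0"
  shows "P u v = 0"
proof (rule ccontr)
  assume ne: "P u v \<noteq> 0"
  \<comment> \<open>This \<open>t\<close> makes the affine function equal to \<open>-1\<close>.\<close>
  define t where "t = - (P v v + 1) / (2 * P u v)"
  have "P (v + t *\<^sub>R u) (v + t *\<^sub>R u) = P v v + 2 * t * P u v"
    by (simp add: bilinear_ladd[OF bil] bilinear_radd[OF bil] bilinear_lmul[OF bil]
        bilinear_rmul[OF bil] sym[of v u] iso)
  also have "\<dots> = -1"
    using ne by (simp add: t_def field_simps)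
  finally show False
    using pos[of "v + t *\<^sub>R u"] by simp
qed

lemma subspace_form_radical:
  assumes "bilinear B"
  shows "subspace (form_radical B)"
  by (auto simp: subspace_def form_radical_def bilinear_lzero[OF assms]
      bilinear_ladd[OF assms] bilinear_lmul[OF assms])

locale norton_algebra =
  fixes m :: "'a::real_vector \<Rightarrow> 'a \<Rightarrow> 'a" (infixl "\<odot>" 70)
    and B :: "'a \<Rightarrow> 'a \<Rightarrow> real"
  assumes algebra: "commutative_algebra m"
    and form: "frobenius_form m B"
    and norton: "norton_inequality m B"
begin

lemma bilinear_product: "bilinear m" and bilinear_form: "bilinear B"
  using algebra form by (auto simp: commutative_algebra_def frobenius_form_def)

lemma product_commute: "x \<odot> y = y \<odot> x"
  using algebra by (auto simp: commutative_algebra_def)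

lemma form_commute: "B x y = B y x"
  and form_assoc: "B (x \<odot> y) z = B x (y \<odot> z)"
  using form by (auto simp: frobenius_form_def)

lemma adjoint_selfadjoint: "B (x \<odot> y) z = B y (x \<odot> z)"
  using form_assoc[of y x z] by (simp add: product_commute)

lemmas bilinear_simps =
  bilinear_ladd[OF bilinear_product] bilinear_radd[OF bilinear_product]
  bilinear_lmul[OF bilinear_product] bilinear_rmul[OF bilinear_product]
  bilinear_ladd[OF bilinear_form] bilinear_radd[OF bilinear_form]
  bilinear_lmul[OF bilinear_form] bilinear_rmul[OF bilinear_form]
  bilinear_lsub[OF bilinear_form]

definition norton_defect :: "'a \<Rightarrow> 'a \<Rightarrow> 'a \<Rightarrow> real" where
  "norton_defect x u v = B (x \<odot> x) (u \<odot> v) - B (x \<odot> u) (x \<odot> v)"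

lemma bilinear_norton_defect: "bilinear (norton_defect x)"
  unfolding bilinear_def
  by (auto intro!: linearI simp: norton_defect_def bilinear_simps algebra_simps)

lemma norton_defect_commute: "norton_defect x u v = norton_defect x v u"
  by (simp add: norton_defect_def product_commute[of u v] form_commute[of "x \<odot> u"])

lemma norton_defect_nonneg: "norton_defect x u u \<ge> 0"
  using norton by (simp add: norton_defect_def norton_inequality_def)

lemma norton_defect_swap: "norton_defect x u u = norton_defect u x x"
  by (simp add: norton_defect_def product_commute[of x u] form_commute[of "x \<odot> x"])

lemma norton_defect_isotropic:
  assumes "norton_defect x u u = 0"
  shows "norton_defect x u v = 0"
  by (rule isotropic_semidefinite[OF bilinear_norton_defect norton_defect_commute
        norton_defect_nonneg assms])

lemma norton_defect_isotropic_add: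
  assumes "norton_defect x u u = 0" and "norton_defect x v v = 0"
  shows "norton_defect x (u + v) (u + v) = 0"
  using assms norton_defect_isotropic
  by (simp add: bilinear_ladd[OF bilinear_norton_defect] bilinear_radd[OF bilinear_norton_defect])

text \<open>
  By the swap symmetry \<open>e\<close> is isotropic for the defect form of \<open>y\<close>; the conclusion rewrites the
  vanishing of that form at \<open>(e, z)\<close>, moving all factors off \<open>z\<close>.
\<close>

lemma isotropic_square:
  assumes "norton_defect e y y = 0"
  shows "B (e \<odot> (y \<odot> y)) z = B ((e \<odot> y) \<odot> y) z"
proof -
  have "norton_defect y e z = 0"
    using assms norton_defect_swap norton_defect_isotropic by metis
  then show ?thesis
    using adjoint_selfadjoint[of e "y \<odot> y" z] form_assoc[of "e \<odot> y" y z]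
    by (simp add: norton_defect_def product_commute[of y e])
qed

lemma isotropic_product:
  assumes "norton_defect e u u = 0" and "norton_defect e v v = 0"
  shows "2 * B (e \<odot> (u \<odot> v)) z = B ((e \<odot> u) \<odot> v) z + B ((e \<odot> v) \<odot> u) z"
  using isotropic_square[OF assms(1), of z] isotropic_square[OF assms(2), of z]
    isotropic_square[OF norton_defect_isotropic_add[OF assms], of z]
  by (simp add: bilinear_simps product_commute[of v u])

text \<open>
  The defect form of an idempotent \<open>e\<close> is \<open>(ey, z) - (ey, ez)\<close>, so an eigenvector \<open>y\<close> for \<open>a\<close>
  gives \<open>(a - a\<^sup>2) (y, y)\<close>, and \<open>a = a\<^sup>2\<close> for \<open>a \<in> {0, 1}\<close>.
\<close>

lemma eigenvector_isotropic:
  assumes "e \<odot> e = e" and "a \<in> {0, 1}" and "e \<odot> y = a *\<^sub>R y"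
  shows "norton_defect e y y = 0"
  using assms by (auto simp: norton_defect_def form_assoc[symmetric] bilinear_simps
      bilinear_lzero[OF bilinear_form])

lemma eigenvector_product:
  assumes "e \<odot> e = e" and "a \<in> {0, 1}" and "b \<in> {0, 1}"
    and "e \<odot> u = a *\<^sub>R u" and "e \<odot> v = b *\<^sub>R v"
  shows "B (e \<odot> (u \<odot> v)) z = (a + b) / 2 * B (u \<odot> v) z"
  using isotropic_product[of e u v z] eigenvector_isotropic assms
  by (simp add: bilinear_simps product_commute[of v u] algebra_simps)

lemma mixed_product_in_radical:
  assumes e: "e \<odot> e = e" and u: "e \<odot> u = 0" and v: "e \<odot> v = v"
  shows "B (u \<odot> v) z = 0"
proof -
  let ?w = "u \<odot> v"
  have half: "B (e \<odot> ?w) y = B ?w y / 2" for y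
    using eigenvector_product[of e 0 1 u v y] assms by simp
  have defect: "norton_defect e ?w y = B ?w y / 4" for y
  proof -
    have "B (e \<odot> e) (?w \<odot> y) = B ?w y / 2"
      using half[of y] by (simp add: e form_assoc[symmetric])
    moreover have "B (e \<odot> ?w) (e \<odot> y) = B ?w y / 4"
      using half[of "e \<odot> y"] half[of y] by (simp add: adjoint_selfadjoint[of e ?w y])
    ultimately show ?thesis
      by (simp add: norton_defect_def)
  qed
  have "B (u \<odot> u) (v \<odot> v) = B (e \<odot> (v \<odot> v)) (u \<odot> u)"
    using eigenvector_product[of e 1 1 v v "u \<odot> u"] e v by (simp add: form_commute)
  also have "\<dots> = B (e \<odot> (u \<odot> u)) (v \<odot> v)"
    using adjoint_selfadjoint[of e "v \<odot> v" "u \<odot> u"] by (metis form_commute)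
  also have "\<dots> = 0"
    using eigenvector_product[of e 0 0 u u "v \<odot> v"] e u by simp
  finally have "B ?w ?w \<le> 0"
    using norton_defect_nonneg[of u v] by (simp add: norton_defect_def)
  then have "norton_defect e ?w ?w = 0"
    using norton_defect_nonneg[of e ?w] by (simp add: defect)
  then show ?thesis
    using norton_defect_isotropic[of e ?w z] by (simp add: defect)
qed

lemma equal_eigenvalue_inclusion:
  assumes e: "e \<odot> e = e" and c: "c \<in> {0, 1}"
    and x: "x \<in> subspace_product m (alg_eigenspace m c e) (alg_eigenspace m c e)"
  shows "e \<odot> x - c *\<^sub>R x \<in> form_radical B"
proof -
  \<comment> \<open>The condition is linear in \<open>x\<close>, so it suffices to check it on products of eigenvectors.\<close>
  have "linear (\<lambda>x. e \<odot> x - c *\<^sub>R x)"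
    by (auto intro!: linearI simp: bilinear_simps algebra_simps)
  then have "subspace ((\<lambda>x. e \<odot> x - c *\<^sub>R x) -` form_radical B)"
    using subspace_form_radical[OF bilinear_form] by (rule linear_subspace_vimage)
  moreover have "{u \<odot> v | u v. u \<in> alg_eigenspace m c e \<and> v \<in> alg_eigenspace m c e}
      \<subseteq> (\<lambda>x. e \<odot> x - c *\<^sub>R x) -` form_radical B"
    using eigenvector_product[OF e c c]
    by (auto simp: alg_eigenspace_def form_radical_def bilinear_simps)
  ultimately show ?thesis
    using x span_minimal unfolding subspace_product_def by blast
qed

lemma mixed_inclusion:
  assumes e: "e \<odot> e = e"
  shows "subspace_product m (alg_eigenspace m 0 e) (alg_eigenspace m 1 e) \<subseteq> form_radical B"
  unfolding subspace_product_def
  by (rule span_minimal[OF _ subspace_form_radical[OF bilinear_form]])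
    (auto simp: alg_eigenspace_def form_radical_def mixed_product_in_radical[OF e])

end

theorem theorem3p3:
  fixes m :: "'a::real_vector \<Rightarrow> 'a \<Rightarrow> 'a"
    and B :: "'a \<Rightarrow> 'a \<Rightarrow> real"
  assumes "commutative_algebra m"
    and "frobenius_form m B"
    and "norton_inequality m B"
  shows "\<forall>e. alg_idempotent m e \<longrightarrow>
    (\<forall>c\<in>{0, 1::real}.
       (\<lambda>v. adjoint_op m e v - c *\<^sub>R v) `
         subspace_product m (alg_eigenspace m c e) (alg_eigenspace m c e)
       \<subseteq> form_radical B) \<and>
    subspace_product m (alg_eigenspace m 0 e) (alg_eigenspace m 1 e) \<subseteq> form_radical B"
proof -
  interpret norton_algebra m B
    using assms by unfold_locales
  show ?thesis
    unfolding alg_idempotent_def adjoint_op_def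
    using equal_eigenvalue_inclusion mixed_inclusion by blast
qed

end
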